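(* Let $S$ be a uniquely divisible $\mathfrak{N}$-semigroup. For each $x, y \in S$, if $f(x) \mid f(y)$ in $\mathbb{R}_{>0}$ for all semigroup homomorphisms $f : S \to \mathbb{R}_{>0}$, then $x \mid y$ in $S$.
   Context: All semigroups are commutative and written additively; $\mathbb{N} = \{1, 2, 3, \dots\}$, and $\mathbb{R}_{>0}$ denotes the additive semigroup of strictly positive real numbers. A semigroup is not assumed to have an identity element. For elements $x, y$ of a commutative semigroup $S$, say that $x$ divides $y$ in $S$, written $x \mid y$, if there is some $z \in S$ with $x + z = y$ (so in $\mathbb{R}_{>0}$, $a \mid b$ is equivalent to the strict inequality $a < b$). For $n \in \mathbb{N}$, $nx$ denotes the $n$-fold sum $x + \cdots + x$. A commutative semigroup $S$ is archimedean if for each $x, y \in S$ there is some $n \in \mathbb{N}$ such that $x \mid ny$ in $S$. An $\mathfrak{N}$-semigroup is an archimedean, idempotent-free (no $e \in S$ satisfies $e + e = e$), cancellative, commutative semigroup. A commutative semigroup $S$ is uniquely divisible if for each $x \in S$ and $n \in \mathbb{N}$ there exists a unique $y \in S$ such that $ny = x$. A semigroup homomorphism $f : S \to \mathbb{R}_{>0}$ is a map with $f(a + b) = f(a) + f(b)$ for all $a, b \in S$. *)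

theory Defs
  imports Complex_Main
begin

context ab_semigroup_add
begin

definition add_dvd :: "'a \<Rightarrow> 'a \<Rightarrow> bool"  (infix \<open>add'_dvd\<close> 50) where
  "x add_dvd y \<longleftrightarrow> (\<exists>z. x + z = y)"

(* The n-fold sum x + ... + x for n >= 1.  Since there need not be a neutral element, the value
   at n = 0 is a dummy (namely x); every use below requires 0 < n. *)
definition nat_multiple :: "nat \<Rightarrow> 'a \<Rightarrow> 'a"  (infixr \<open>\<cdot>\<^sub>+\<close> 75) where
  "n \<cdot>\<^sub>+ x = ((+) x ^^ (n - 1)) x"

lemma nat_multiple_1: "1 \<cdot>\<^sub>+ x = x"
  by (simp add: nat_multiple_def)

lemma nat_multiple_Suc: "0 < n \<Longrightarrow> Suc n \<cdot>\<^sub>+ x = x + n \<cdot>\<^sub>+ x"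
  by (cases n) (simp_all add: nat_multiple_def)

end

class archimedean_semigroup = ab_semigroup_add +
  assumes archimedean: "\<exists>n>0. x add_dvd n \<cdot>\<^sub>+ y"

class idempotent_free_semigroup = ab_semigroup_add +
  assumes idempotent_free: "e + e \<noteq> e"

(* Cancellativity comes from cancel_semigroup_add.  The class cancel_ab_semigroup_add would be
   wrong here: it requires a total subtraction satisfying further laws. *)
class N_semigroup = archimedean_semigroup + idempotent_free_semigroup + cancel_semigroup_add

class uniquely_divisible_semigroup = ab_semigroup_add +
  assumes uniquely_divisible: "0 < n \<Longrightarrow> \<exists>!y. n \<cdot>\<^sub>+ y = x"

definition semigroup_hom :: "('a::ab_semigroup_add \<Rightarrow> 'b::ab_semigroup_add) \<Rightarrow> bool" where
  "semigroup_hom f \<longleftrightarrow> (\<forall>a b. f (a + b) = f a + f b)"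

typedef pos_real = "{x::real. 0 < x}"
  morphisms real_of_pos_real Abs_pos_real
  by (rule exI[of _ 1]) simp

setup_lifting type_definition_pos_real

instantiation pos_real :: ab_semigroup_add
begin

lift_definition plus_pos_real :: "pos_real \<Rightarrow> pos_real \<Rightarrow> pos_real" is "(+)"
  by simp

instance
  by standard (transfer; simp)+

end

lemma pos_real_add_dvd_iff: "a add_dvd b \<longleftrightarrow> real_of_pos_real a < real_of_pos_real b"
  unfolding add_dvd_def
proof (transfer, safe)
  fix a b :: real
  assume "0 < a" "a < b"
  then show "\<exists>z\<in>{x. 0 < x}. a + z = b"
    by (intro bexI[of _ "b - a"]) auto
qed simp

end

theory Submission
  imports Defs
begin

text \<open>
  Think of \<open>S\<close> as the open positive cone of an ordered rational vector space: \<open>x\<close> divides \<open>y\<close> iff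
  \<open>y - x\<close> lies in the cone, and the archimedean axiom says that every point of the cone is interior.
  The theorem is then the Hahn-Banach separation of a point \<open>y - x\<close> outside an open convex cone
  from that cone.  The proof below carries this out inside \<open>S\<close>, replacing linear functionals by
  translation-invariant total preorders, so that no group of differences has to be constructed.

  Suppose that \<open>x\<close> does not divide \<open>y\<close>.  The relation ``equal or divides'' is a translation-invariant
  preorder in which every element is strictly positive.  Adjoining the inequality \<open>y \<le> x\<close> to it could
  only violate strict positivity if \<open>k \<cdot>\<^sub>+ x\<close> divided \<open>k \<cdot>\<^sub>+ y\<close> for some \<open>k\<close>, and unique divisibility turns
  this into \<open>x\<close> dividing \<open>y\<close>.  So the inequality can be adjoined
  (\<open>positive_preorder_adjoin\<close>), and Zorn's lemma extends the result to a \<^emph>\<open>total\<close> preorder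
  (\<open>positive_preorder.total_extension\<close>): if each of two opposite inequalities led to a
  contradiction, so would a positive combination of the two contradictions.

  In a total preorder, the archimedean axiom permits measuring every element against a fixed unit
  \<open>u\<close>, as in Hoelder's theorem: sending \<open>a\<close> to the supremum of all \<open>m / n\<close> with \<open>m \<cdot>\<^sub>+ u \<le> n \<cdot>\<^sub>+ a\<close>
  is a monotone homomorphism to the positive reals (\<open>ex_monotone_hom\<close>).  As \<open>y \<le> x\<close>, it maps
  \<open>y\<close> to at most the image of \<open>x\<close>, contrary to the hypothesis on homomorphisms.
\<close>

section \<open>Multiples in a commutative semigroup\<close>

context ab_semigroup_add
begin

lemma nat_multiple_Suc_0 [simp]: "Suc 0 \<cdot>\<^sub>+ x = x"
  using nat_multiple_1 by simp

lemma nat_multiple_add: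
  assumes "0 < m" "0 < n"
  shows "(m + n) \<cdot>\<^sub>+ x = m \<cdot>\<^sub>+ x + n \<cdot>\<^sub>+ x"
  using assms(1)
proof (induction m rule: nat_induct_non_zero)
  case 1
  show ?case using nat_multiple_Suc[OF assms(2), of x] by simp
next
  case (Suc m)
  then show ?case using assms(2) by (simp add: nat_multiple_Suc add.assoc)
qed

lemma nat_multiple_distrib:
  assumes "0 < n"
  shows "n \<cdot>\<^sub>+ (x + y) = n \<cdot>\<^sub>+ x + n \<cdot>\<^sub>+ y"
  using assms
proof (induction n rule: nat_induct_non_zero)
  case 1
  show ?case by simp
next
  case (Suc n)
  then show ?case by (simp add: nat_multiple_Suc add.assoc add.left_commute)
qed

lemma nat_multiple_mult:
  assumes "0 < m" "0 < n"
  shows "(m * n) \<cdot>\<^sub>+ x = m \<cdot>\<^sub>+ (n \<cdot>\<^sub>+ x)"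
  using assms(1)
proof (induction m rule: nat_induct_non_zero)
  case 1
  show ?case by simp
next
  case (Suc m)
  then show ?case using assms(2) by (simp add: nat_multiple_Suc nat_multiple_add)
qed

end


section \<open>Positive preorders and their total extensions\<close>

locale positive_preorder =
  fixes R :: "('a::ab_semigroup_add) rel"
  assumes refl: "(a, a) \<in> R"
    and trans: "(a, b) \<in> R \<Longrightarrow> (b, c) \<in> R \<Longrightarrow> (a, c) \<in> R"
    and add_right: "(a, b) \<in> R \<Longrightarrow> (a + z, b + z) \<in> R"
    and increasing: "(a, a + z) \<in> R"
    and strict: "(a + z, a) \<notin> R"
begin

lemma add_mono:
  assumes "(a, b) \<in> R" "(c, d) \<in> R"
  shows "(a + c, b + d) \<in> R"
  using add_right[OF assms(1), of c] add_right[OF assms(2), of b]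
  by (auto intro: trans simp: add.commute)

lemma multiple_mono:
  assumes "(a, b) \<in> R" "0 < n"
  shows "(n \<cdot>\<^sub>+ a, n \<cdot>\<^sub>+ b) \<in> R"
  using assms(2)
proof (induction n rule: nat_induct_non_zero)
  case 1
  show ?case using assms(1) by simp
next
  case (Suc n)
  then show ?case using assms(1) by (simp add: nat_multiple_Suc add_mono)
qed

lemma multiples_le_imp_le:
  assumes "(p \<cdot>\<^sub>+ u, q \<cdot>\<^sub>+ u) \<in> R" "0 < q"
  shows "p \<le> q"
proof (rule ccontr)
  assume "\<not> p \<le> q"
  then have "p \<cdot>\<^sub>+ u = q \<cdot>\<^sub>+ u + (p - q) \<cdot>\<^sub>+ u"
    using nat_multiple_add[of q "p - q" u] assms(2) by simp
  then show False using assms(1) strict by metis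
qed

end

text \<open>
  The preorder generated by \<open>R\<close> and the inequality \<open>d \<le> c\<close>.  Formally \<open>a \<le> b\<close> must follow
  from \<open>a + k \<cdot>\<^sub>+ (c - d) \<le> b\<close>, whence the form of the second set.  It covers \<open>0 < k\<close> only, since
  \<open>0 \<cdot>\<^sub>+ c\<close> is a dummy value; the summand \<open>R\<close> stands for \<open>k = 0\<close>.
\<close>

definition adjoin :: "('a::ab_semigroup_add) rel \<Rightarrow> 'a \<Rightarrow> 'a \<Rightarrow> 'a rel" where
  "adjoin R d c = R \<union> {(a, b). \<exists>k>0. (a + k \<cdot>\<^sub>+ c, b + k \<cdot>\<^sub>+ d) \<in> R}"

lemma adjoinI: "0 < k \<Longrightarrow> (a + k \<cdot>\<^sub>+ c, b + k \<cdot>\<^sub>+ d) \<in> R \<Longrightarrow> (a, b) \<in> adjoin R d c"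
  by (auto simp: adjoin_def)

lemma adjoinE:
  assumes "(a, b) \<in> adjoin R d c"
  obtains "(a, b) \<in> R" | k where "0 < k" "(a + k \<cdot>\<^sub>+ c, b + k \<cdot>\<^sub>+ d) \<in> R"
  using assms by (auto simp: adjoin_def)

lemma subset_adjoin: "R \<subseteq> adjoin R d c"
  by (auto simp: adjoin_def)

lemma (in positive_preorder) adjoined: "(d, c) \<in> adjoin R d c"
  by (rule adjoinI[of 1]) (simp_all add: add.commute refl)

text \<open>
  Only strict positivity can fail when an inequality is adjoined; for the other axioms, the
  multiplicities \<open>k\<close> of the adjoined inequality add up.
\<close>

lemma (in positive_preorder) positive_preorder_adjoin:
  assumes consistent: "\<And>k u z. 0 < k \<Longrightarrow> (u + z + k \<cdot>\<^sub>+ c, z + k \<cdot>\<^sub>+ d) \<notin> R"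
  shows "positive_preorder (adjoin R d c)"
proof
  show "(a, a) \<in> adjoin R d c" for a
    using refl subset_adjoin by blast
  show "(a, a + z) \<in> adjoin R d c" for a z
    using increasing subset_adjoin by blast
  show "(a + z, a) \<notin> adjoin R d c" for a z
    using strict[of a z] consistent[of _ z a] by (auto simp: add.commute elim!: adjoinE)
  show "(a + z, b + z) \<in> adjoin R d c" if ab: "(a, b) \<in> adjoin R d c" for a b z
    using ab
  proof (cases rule: adjoinE)
    case 1
    then show ?thesis using add_right subset_adjoin by blast
  next
    case (2 k)
    from add_right[OF 2(2), of z] show ?thesis
      by (intro adjoinI[OF 2(1)]) (simp add: ac_simps)
  qed
  show "(a, e) \<in> adjoin R d c"
    if ab: "(a, b) \<in> adjoin R d c" and be: "(b, e) \<in> adjoin R d c" for a b e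
    using ab
  proof (cases rule: adjoinE)
    case ab: 1
    from be show ?thesis
    proof (cases rule: adjoinE)
      case 1
      then show ?thesis using ab trans subset_adjoin by blast
    next
      case (2 l)
      then show ?thesis using add_right[OF ab] trans adjoinI by metis
    qed
  next
    case ab: (2 k)
    from be show ?thesis
    proof (cases rule: adjoinE)
      case 1
      then show ?thesis using ab add_right trans adjoinI by metis
    next
      case (2 l)
      have "(a + k \<cdot>\<^sub>+ c + l \<cdot>\<^sub>+ c, b + k \<cdot>\<^sub>+ d + l \<cdot>\<^sub>+ c) \<in> R"
        by (rule add_right[OF ab(2)])
      moreover have "(b + l \<cdot>\<^sub>+ c + k \<cdot>\<^sub>+ d, e + l \<cdot>\<^sub>+ d + k \<cdot>\<^sub>+ d) \<in> R"
        by (rule add_right[OF 2(2)])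
      ultimately have "(a + (k + l) \<cdot>\<^sub>+ c, e + (k + l) \<cdot>\<^sub>+ d) \<in> R"
        using ab(1) 2(1) trans by (simp add: nat_multiple_add ac_simps)
      then show ?thesis using ab(1) by (intro adjoinI[of "k + l"]) auto
    qed
  qed
qed

text \<open>
  Two opposite inequalities cannot both be inconsistent with \<open>R\<close>: scaling the two violations of
  strict positivity so that \<open>c\<close> and \<open>d\<close> occur equally often, and adding them up, gives a violation
  in \<open>R\<close> itself.
\<close>

lemma (in positive_preorder) adjoin_either:
  "positive_preorder (adjoin R d c) \<or> positive_preorder (adjoin R c d)"
proof (rule ccontr)
  assume "\<not> ?thesis"
  then obtain k u z l v w where k: "0 < k" "(u + z + k \<cdot>\<^sub>+ c, z + k \<cdot>\<^sub>+ d) \<in> R"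
    and l: "0 < l" "(v + w + l \<cdot>\<^sub>+ d, w + l \<cdot>\<^sub>+ c) \<in> R"
    using positive_preorder_adjoin by metis
  let ?W = "l \<cdot>\<^sub>+ z + k \<cdot>\<^sub>+ w + (k * l) \<cdot>\<^sub>+ c + (k * l) \<cdot>\<^sub>+ d"
  have "(l \<cdot>\<^sub>+ (u + z + k \<cdot>\<^sub>+ c) + k \<cdot>\<^sub>+ (v + w + l \<cdot>\<^sub>+ d),
         l \<cdot>\<^sub>+ (z + k \<cdot>\<^sub>+ d) + k \<cdot>\<^sub>+ (w + l \<cdot>\<^sub>+ c)) \<in> R"
    by (rule add_mono[OF multiple_mono[OF k(2) l(1)] multiple_mono[OF l(2) k(1)]])
  then have "(?W + (l \<cdot>\<^sub>+ u + k \<cdot>\<^sub>+ v), ?W) \<in> R"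
    using k(1) l(1)
    by (simp add: nat_multiple_distrib flip: nat_multiple_mult) (simp add: ac_simps)
  then show False using strict by blast
qed

lemma positive_preorder_Union_chain:
  assumes "C \<noteq> {}" and pos: "\<And>R. R \<in> C \<Longrightarrow> positive_preorder R"
    and chain: "\<And>R R'. R \<in> C \<Longrightarrow> R' \<in> C \<Longrightarrow> R \<subseteq> R' \<or> R' \<subseteq> R"
  shows "positive_preorder (\<Union>C)"
proof
  from \<open>C \<noteq> {}\<close> obtain R where R: "R \<in> C" by blast
  show "(a, a) \<in> \<Union>C" "(a, a + z) \<in> \<Union>C" for a z
    using R positive_preorder.refl[OF pos] positive_preorder.increasing[OF pos] by blast+
  show "(a + z, a) \<notin> \<Union>C" for a z
    using positive_preorder.strict[OF pos] by blast
  show "(a + z, b + z) \<in> \<Union>C" if "(a, b) \<in> \<Union>C" for a b z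
    using that positive_preorder.add_right[OF pos] by blast
  show "(a, e) \<in> \<Union>C" if ab: "(a, b) \<in> \<Union>C" and be: "(b, e) \<in> \<Union>C" for a b e
  proof -
    from ab be obtain R' where "R' \<in> C" "(a, b) \<in> R'" "(b, e) \<in> R'"
      using chain by blast
    then show ?thesis using positive_preorder.trans[OF pos] by blast
  qed
qed

locale total_positive_preorder = positive_preorder +
  assumes total: "(a, b) \<in> R \<or> (b, a) \<in> R"

lemma (in positive_preorder) total_extension:
  obtains T where "total_positive_preorder T" "R \<subseteq> T"
proof -
  let ?A = "{T. positive_preorder T \<and> R \<subseteq> T}"
  have "\<exists>M\<in>?A. \<forall>T\<in>?A. M \<subseteq> T \<longrightarrow> T = M"
  proof (rule subset_Zorn_nonempty)
    show "?A \<noteq> {}" using positive_preorder_axioms by blast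
    show "\<Union>C \<in> ?A" if "C \<noteq> {}" "subset.chain ?A C" for C
    proof -
      have "positive_preorder (\<Union>C)"
        using that by (intro positive_preorder_Union_chain) (auto simp: subset_chain_def)
      moreover have "R \<subseteq> \<Union>C"
        using that unfolding subset_chain_def by blast
      ultimately show ?thesis by blast
    qed
  qed
  then obtain M where M: "positive_preorder M" "R \<subseteq> M"
    and maximal: "\<And>T. positive_preorder T \<Longrightarrow> M \<subseteq> T \<Longrightarrow> T = M"
    by (metis (mono_tags, lifting) mem_Collect_eq subset_trans)
  interpret M: positive_preorder M by (fact M)
  have "(a, b) \<in> M \<or> (b, a) \<in> M" for a b
    using M.adjoin_either[of a b] maximal subset_adjoin M.adjoined by metis
  then have "total_positive_preorder M" by unfold_locales
  then show ?thesis using that M(2) by blast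
qed


section \<open>Measuring against a unit\<close>

text \<open>
  The lower half of the Dedekind cut that represents the quotient of \<open>a\<close> by \<open>u\<close>.
\<close>

definition lower_ratios :: "('a::ab_semigroup_add) rel \<Rightarrow> 'a \<Rightarrow> 'a \<Rightarrow> real set" where
  "lower_ratios R u a = {real m / real n | m n. 0 < m \<and> 0 < n \<and> (m \<cdot>\<^sub>+ u, n \<cdot>\<^sub>+ a) \<in> R}"

definition ratio :: "('a::ab_semigroup_add) rel \<Rightarrow> 'a \<Rightarrow> 'a \<Rightarrow> real" where
  "ratio R u a = Sup (lower_ratios R u a)"

context positive_preorder
begin

lemma lower_ratio_le:
  assumes "0 < m" "0 < n" "(n \<cdot>\<^sub>+ a, m \<cdot>\<^sub>+ u) \<in> R" "r \<in> lower_ratios R u a"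
  shows "r \<le> m / n"
proof -
  from assms(4) obtain p q where r: "r = real p / real q"
    and pq: "0 < p" "0 < q" "(p \<cdot>\<^sub>+ u, q \<cdot>\<^sub>+ a) \<in> R"
    by (auto simp: lower_ratios_def)
  have "((n * p) \<cdot>\<^sub>+ u, (n * q) \<cdot>\<^sub>+ a) \<in> R"
    using multiple_mono[OF pq(3) assms(2)] pq assms(2) by (simp add: nat_multiple_mult)
  moreover have "((q * n) \<cdot>\<^sub>+ a, (q * m) \<cdot>\<^sub>+ u) \<in> R"
    using multiple_mono[OF assms(3) pq(2)] pq assms by (simp add: nat_multiple_mult)
  ultimately have "((n * p) \<cdot>\<^sub>+ u, (q * m) \<cdot>\<^sub>+ u) \<in> R"
    by (metis mult.commute trans)
  then have "n * p \<le> q * m"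
    using multiples_le_imp_le pq assms by simp
  then have "real n * real p \<le> real q * real m"
    by (metis of_nat_le_iff of_nat_mult)
  then show ?thesis
    using pq assms by (simp add: r field_simps)
qed

lemma lower_ratios_mono:
  assumes "(a, b) \<in> R"
  shows "lower_ratios R u a \<subseteq> lower_ratios R u b"
  using multiple_mono[OF assms] trans unfolding lower_ratios_def by blast

lemma lower_ratios_add:
  assumes "r \<in> lower_ratios R u a" "s \<in> lower_ratios R u b"
  shows "r + s \<in> lower_ratios R u (a + b)"
proof -
  from assms obtain m n p q where r: "r = real m / real n" "0 < m" "0 < n" "(m \<cdot>\<^sub>+ u, n \<cdot>\<^sub>+ a) \<in> R"
    and s: "s = real p / real q" "0 < p" "0 < q" "(p \<cdot>\<^sub>+ u, q \<cdot>\<^sub>+ b) \<in> R"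
    by (auto simp: lower_ratios_def)
  have "(q \<cdot>\<^sub>+ m \<cdot>\<^sub>+ u + n \<cdot>\<^sub>+ p \<cdot>\<^sub>+ u, q \<cdot>\<^sub>+ n \<cdot>\<^sub>+ a + n \<cdot>\<^sub>+ q \<cdot>\<^sub>+ b) \<in> R"
    using r s by (intro add_mono multiple_mono)
  then have "((q * m + n * p) \<cdot>\<^sub>+ u, (n * q) \<cdot>\<^sub>+ (a + b)) \<in> R"
    using r s by (simp add: nat_multiple_add nat_multiple_distrib mult.commute[of n q]
        flip: nat_multiple_mult)
  moreover have "r + s = real (q * m + n * p) / real (n * q)"
    using r s by (simp add: field_simps)
  moreover have "0 < q * m + n * p" "0 < n * q" using r s by simp_all
  ultimately show ?thesis unfolding lower_ratios_def by blast
qed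

end

locale archimedean_positive_preorder =
  positive_preorder R for R :: "('a::archimedean_semigroup) rel"
begin

lemma lower_ratios_nonempty: "lower_ratios R u a \<noteq> {}"
proof -
  obtain n z where "0 < n" "u + z = n \<cdot>\<^sub>+ a"
    using archimedean[of u a] by (auto simp: add_dvd_def)
  then have "(1 \<cdot>\<^sub>+ u, n \<cdot>\<^sub>+ a) \<in> R"
    using increasing[of u z] by simp
  then show ?thesis using \<open>0 < n\<close> unfolding lower_ratios_def by blast
qed

lemma lower_ratios_bdd_above: "bdd_above (lower_ratios R u a)"
proof -
  obtain m z where "0 < m" "a + z = m \<cdot>\<^sub>+ u"
    using archimedean[of a u] by (auto simp: add_dvd_def)
  then have "(1 \<cdot>\<^sub>+ a, m \<cdot>\<^sub>+ u) \<in> R"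
    using increasing[of a z] by simp
  then show ?thesis
    using lower_ratio_le[OF \<open>0 < m\<close>, of 1] by (meson bdd_aboveI zero_less_one)
qed

lemma lower_ratio_le_ratio: "r \<in> lower_ratios R u a \<Longrightarrow> r \<le> ratio R u a"
  unfolding ratio_def by (rule cSup_upper[OF _ lower_ratios_bdd_above])

lemma ratio_le: "(\<And>r. r \<in> lower_ratios R u a \<Longrightarrow> r \<le> t) \<Longrightarrow> ratio R u a \<le> t"
  unfolding ratio_def by (rule cSup_least[OF lower_ratios_nonempty])

lemma ratio_pos: "0 < ratio R u a"
proof -
  obtain r where r: "r \<in> lower_ratios R u a" using lower_ratios_nonempty by blast
  then have "0 < r" by (auto simp: lower_ratios_def)
  with lower_ratio_le_ratio[OF r] show ?thesis by simp
qed

lemma ratio_mono: "(a, b) \<in> R \<Longrightarrow> ratio R u a \<le> ratio R u b"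
  using lower_ratios_mono by (blast intro: ratio_le lower_ratio_le_ratio)

lemma ratio_superadditive: "ratio R u a + ratio R u b \<le> ratio R u (a + b)"
proof -
  have "ratio R u a \<le> ratio R u (a + b) - s" if s: "s \<in> lower_ratios R u b" for s
    using lower_ratio_le_ratio[OF lower_ratios_add[OF _ s]] by (intro ratio_le) (simp add: le_diff_eq)
  then have "ratio R u b \<le> ratio R u (a + b) - ratio R u a"
    by (intro ratio_le) (simp add: le_diff_eq add.commute)
  then show ?thesis by simp
qed

end

text \<open>
  Totality enters here: a fraction above the supremum is not a lower ratio, hence it is an upper
  one.  So \<open>n \<cdot>\<^sub>+ a\<close> can be bounded by a multiple of \<open>u\<close> with an error of one unit, whatever \<open>n\<close> is.
\<close>

lemma (in archimedean_positive_preorder) ratio_upper_multiple: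
  assumes total: "\<And>a b. (a, b) \<in> R \<or> (b, a) \<in> R" and "0 < n"
  obtains m where "0 < m" "(n \<cdot>\<^sub>+ a, m \<cdot>\<^sub>+ u) \<in> R" "m \<le> n * ratio R u a + 1"
proof -
  let ?t = "n * ratio R u a"
  define m where "m = Suc (nat \<lfloor>?t\<rfloor>)"
  have "0 \<le> ?t" using ratio_pos[of u a] by simp
  then have m: "?t < m" "m \<le> ?t + 1" unfolding m_def by linarith+
  have "real m / real n \<notin> lower_ratios R u a"
    using m(1) lower_ratio_le_ratio[of "real m / real n" u a] \<open>0 < n\<close> by (auto simp: field_simps)
  then have "(m \<cdot>\<^sub>+ u, n \<cdot>\<^sub>+ a) \<notin> R"
    using \<open>0 < n\<close> unfolding lower_ratios_def m_def by blast
  then have "(n \<cdot>\<^sub>+ a, m \<cdot>\<^sub>+ u) \<in> R" using total by blast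
  with m(2) that[of m] show ?thesis by (simp add: m_def)
qed

text \<open>
  Subadditivity holds up to an error of two units after multiplication by any \<open>n\<close>, hence exactly.
\<close>

lemma (in archimedean_positive_preorder) ratio_additive:
  assumes total: "\<And>a b. (a, b) \<in> R \<or> (b, a) \<in> R"
  shows "ratio R u (a + b) = ratio R u a + ratio R u b"
proof (rule antisym[OF _ ratio_superadditive], rule ccontr)
  let ?d = "ratio R u (a + b) - (ratio R u a + ratio R u b)"
  assume "\<not> ratio R u (a + b) \<le> ratio R u a + ratio R u b"
  then have "0 < ?d" by simp
  then obtain n where n: "2 < real n * ?d" using reals_Archimedean3 by blast
  then have "0 < n" by (cases n) auto
  obtain k where k: "0 < k" "(n \<cdot>\<^sub>+ a, k \<cdot>\<^sub>+ u) \<in> R" "k \<le> n * ratio R u a + 1"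
    using ratio_upper_multiple[OF total \<open>0 < n\<close>] .
  obtain l where l: "0 < l" "(n \<cdot>\<^sub>+ b, l \<cdot>\<^sub>+ u) \<in> R" "l \<le> n * ratio R u b + 1"
    using ratio_upper_multiple[OF total \<open>0 < n\<close>] .
  have "(n \<cdot>\<^sub>+ (a + b), (k + l) \<cdot>\<^sub>+ u) \<in> R"
    using add_mono[OF k(2) l(2)] k l \<open>0 < n\<close> by (simp add: nat_multiple_add nat_multiple_distrib)
  then have "ratio R u (a + b) \<le> real (k + l) / n"
    using lower_ratio_le[of "k + l" n] k(1) \<open>0 < n\<close> by (intro ratio_le) auto
  then have "n * ratio R u (a + b) \<le> k + l"
    using \<open>0 < n\<close> by (simp add: field_simps)
  then show False using n k(3) l(3) by (simp add: algebra_simps)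
qed

lemma ex_monotone_hom:
  fixes T :: "('a::archimedean_semigroup) rel"
  assumes "total_positive_preorder T"
  obtains f :: "'a \<Rightarrow> pos_real" where "semigroup_hom f"
    and "\<And>a b. (a, b) \<in> T \<Longrightarrow> real_of_pos_real (f a) \<le> real_of_pos_real (f b)"
proof -
  interpret total_positive_preorder T by fact
  interpret archimedean_positive_preorder T ..
  \<comment> \<open>Any element serves as the unit.\<close>
  define f where "f a = Abs_pos_real (ratio T undefined a)" for a
  have real_f: "real_of_pos_real (f a) = ratio T undefined a" for a
    unfolding f_def by (rule Abs_pos_real_inverse) (simp add: ratio_pos)
  have "semigroup_hom f"
    unfolding semigroup_hom_def
    by (simp flip: real_of_pos_real_inject add: plus_pos_real.rep_eq real_f ratio_additive[OF total])
  then show ?thesis using that ratio_mono real_f by simp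
qed


section \<open>Separation in a uniquely divisible semigroup\<close>

text \<open>
  A relation \<open>a + z = a\<close> would make \<open>z\<close> idempotent by cancellation, so divisibility is strict.
\<close>

lemma positive_preorder_add_dvd:
  "positive_preorder {(a, b :: 'a :: N_semigroup). a = b \<or> a add_dvd b}"
proof
  have no_identity: "a + z \<noteq> a" for a z :: 'a
  proof
    assume "a + z = a"
    then have "a + (z + z) = a + z" by (simp flip: add.assoc)
    then show False by (simp add: idempotent_free)
  qed
  then show "(a + z, a) \<notin> {(a, b). a = b \<or> a add_dvd b}" for a z :: 'a
    by (auto simp: add_dvd_def add.assoc)
qed (auto simp: add_dvd_def ac_simps; metis add.assoc add.commute)+

lemma add_dvd_of_nat_multiple_add_dvd:
  fixes x y :: "'a :: uniquely_divisible_semigroup"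
  assumes "0 < k" "(k \<cdot>\<^sub>+ x) add_dvd (k \<cdot>\<^sub>+ y)"
  shows "x add_dvd y"
proof -
  from assms(2) obtain s where "k \<cdot>\<^sub>+ x + s = k \<cdot>\<^sub>+ y" by (auto simp: add_dvd_def)
  moreover obtain t where "k \<cdot>\<^sub>+ t = s" using uniquely_divisible[OF assms(1)] by blast
  ultimately have "k \<cdot>\<^sub>+ (x + t) = k \<cdot>\<^sub>+ y" by (simp add: nat_multiple_distrib assms(1))
  then have "x + t = y" using uniquely_divisible[OF assms(1)] by metis
  then show ?thesis by (auto simp: add_dvd_def)
qed

theorem theorem1:
  fixes x y :: "'s :: {N_semigroup, uniquely_divisible_semigroup}"
  assumes "\<And>f :: 's \<Rightarrow> pos_real. semigroup_hom f \<Longrightarrow> f x add_dvd f y"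
  shows "x add_dvd y"
proof (rule ccontr)
  assume not_dvd: "\<not> x add_dvd y"
  let ?D = "{(a, b :: 's). a = b \<or> a add_dvd b}"
  interpret D: positive_preorder ?D by (rule positive_preorder_add_dvd)
  have consistent: "(u + z + k \<cdot>\<^sub>+ x, z + k \<cdot>\<^sub>+ y) \<notin> ?D" if "0 < k" for k u z
  proof
    assume "(u + z + k \<cdot>\<^sub>+ x, z + k \<cdot>\<^sub>+ y) \<in> ?D"
    then have "\<exists>w. z + (k \<cdot>\<^sub>+ x + w) = z + k \<cdot>\<^sub>+ y"
      by (auto simp: add_dvd_def ac_simps) (metis add.assoc add.commute)+
    then have "(k \<cdot>\<^sub>+ x) add_dvd (k \<cdot>\<^sub>+ y)" by (auto simp: add_dvd_def)
    then show False using add_dvd_of_nat_multiple_add_dvd that not_dvd by blast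
  qed
  interpret E: positive_preorder "adjoin ?D y x"
    using D.positive_preorder_adjoin consistent by blast
  obtain T where T: "total_positive_preorder T" "adjoin ?D y x \<subseteq> T"
    using E.total_extension .
  obtain f :: "'s \<Rightarrow> pos_real" where "semigroup_hom f"
    and mono: "\<And>a b. (a, b) \<in> T \<Longrightarrow> real_of_pos_real (f a) \<le> real_of_pos_real (f b)"
    using ex_monotone_hom[OF T(1)] by blast
  then have "real_of_pos_real (f x) < real_of_pos_real (f y)"
    using assms pos_real_add_dvd_iff by blast
  moreover have "(y, x) \<in> T" using D.adjoined T(2) by blast
  ultimately show False using mono by fastforce
qed

end
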